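(* Let $F:\mathbb{R}^p\to\mathbb{R}^p$ be single-valued, monotone and $L$-Lipschitz continuous ($L>0$), let $T:\mathbb{R}^p\rightrightarrows2^{\mathbb{R}^p}$ be maximally $3$-cyclically monotone, let $\Phi:=F+T$ and suppose $\mathrm{zer}(\Phi)\neq\emptyset$. Let $x^0\in\mathrm{dom}(\Phi)$ and let $\{(x^k,y^k)\}_{k\ge0}$ be generated by $$y^k:=J_{\hat\eta_kT}\big(\tau_kx^0+(1-\tau_k)x^k-\hat\eta_kFx^k\big),\qquad x^{k+1}:=J_{\eta_kT}\big(\tau_kx^0+(1-\tau_k)x^k-\eta_kFy^k\big),\qquad k\ge0,$$ with $$\tau_k:=\frac1{k+2},\qquad\eta_k:=\eta\in\Big(0,\frac1L\Big],\qquad\hat\eta_k:=(1-\tau_k)\eta .$$ Then, for all $k\ge0$ and any $x^\star\in\mathrm{zer}(\Phi)$, $$\|Fx^k+\xi^k\|^2\le\frac{4\|x^0-x^\star\|^2+2\eta^2\|Fx^0+\xi^0\|^2}{\eta^2(k+1)^2},$$ where $\xi^k\in Tx^k$ is as specified in the context. Consequently, $\|Fx^k+\xi^k\|=\mathcal{O}(1/k)$.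
   Context: $\mathbb{R}^p$ carries the standard inner product and Euclidean norm. $\mathrm{dom}(\Phi)=\mathrm{dom}(F)\cap\mathrm{dom}(T)$ and $\mathrm{zer}(\Phi):=\{x\in\mathrm{dom}(\Phi):0\in Fx+Tx\}$. $J_{\eta T}:=(\mathrm{Id}+\eta T)^{-1}$ is the resolvent of $\eta T$. $T$ is $3$-cyclically monotone if $\langle u^1,x^1-x^2\rangle+\langle u^2,x^2-x^3\rangle+\langle u^3,x^3-x^1\rangle\ge0$ for all $(x^i,u^i)\in\mathrm{gra}(T)$, $i=1,2,3$; it is maximally $3$-cyclically monotone if its graph is not properly contained in the graph of another $3$-cyclically monotone operator. The iterates are assumed to be well defined (resolvents nonempty at the required points, iterates in $\mathrm{dom}(F)$). Here $\xi^0\in Tx^0$ is arbitrary and, for $k\ge0$, $\xi^{k+1}:=\frac1{\eta_k}\big(\tau_kx^0+(1-\tau_k)x^k-\eta_kFy^k-x^{k+1}\big)\in Tx^{k+1}$ is the element determined by the resolvent step. *)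

theory Defs
  imports "HOL-Analysis.Analysis" "HOL-Library.Landau_Symbols"
begin

text \<open>Set-valued operators on a space \<open>'a\<close> are functions \<open>'a \<Rightarrow> 'a set\<close>.\<close>

definition graph_op :: "('a \<Rightarrow> 'a set) \<Rightarrow> ('a \<times> 'a) set" where
  "graph_op A = {(x, u). u \<in> A x}"

definition dom_op :: "('a \<Rightarrow> 'a set) \<Rightarrow> 'a set" where
  "dom_op A = {x. A x \<noteq> {}}"

definition inverse_op :: "('a \<Rightarrow> 'a set) \<Rightarrow> 'a \<Rightarrow> 'a set" where
  "inverse_op A u = {x. u \<in> A x}"

definition zer :: "('a::zero \<Rightarrow> 'a set) \<Rightarrow> 'a set" where
  "zer A = {x \<in> dom_op A. 0 \<in> A x}"

text \<open>The sum \<open>F + T\<close> of a single-valued operator \<open>F\<close> with domain \<open>D\<close> and a set-valued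
  operator \<open>T\<close>. HOL functions are total, so the domain of \<open>F\<close> is carried as a separate set and
  the values of \<open>F\<close> outside \<open>D\<close> are irrelevant.\<close>

definition sum_op :: "'a set \<Rightarrow> ('a::plus \<Rightarrow> 'a) \<Rightarrow> ('a \<Rightarrow> 'a set) \<Rightarrow> 'a \<Rightarrow> 'a set" where
  "sum_op D F T x = (if x \<in> D then {F x + u | u. u \<in> T x} else {})"

lemma dom_sum_op: "dom_op (sum_op D F T) = D \<inter> dom_op T"
  by (auto simp: dom_op_def sum_op_def)

text \<open>The resolvent \<open>(Id + \<lambda> T)\<inverse>\<close>, as a set-valued operator. It is at most single-valued when
  \<open>T\<close> is monotone and \<open>\<lambda> > 0\<close> (lemma \<open>resolvent_unique\<close> below), so that \<open>y = J z\<close> amounts to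
  \<open>y \<in> resolvent \<lambda> T z\<close>, including nonemptiness.\<close>

definition resolvent :: "real \<Rightarrow> ('a::real_vector \<Rightarrow> 'a set) \<Rightarrow> 'a \<Rightarrow> 'a set" where
  "resolvent lam T = inverse_op (\<lambda>x. {x + lam *\<^sub>R u | u. u \<in> T x})"

definition monotone_map_on :: "'a::real_inner set \<Rightarrow> ('a \<Rightarrow> 'a) \<Rightarrow> bool" where
  "monotone_map_on D F \<longleftrightarrow> (\<forall>x\<in>D. \<forall>y\<in>D. inner (F x - F y) (x - y) \<ge> 0)"

definition cyclically_monotone3 :: "('a::real_inner \<Rightarrow> 'a set) \<Rightarrow> bool" where
  "cyclically_monotone3 T \<longleftrightarrow>
     (\<forall>x1 u1 x2 u2 x3 u3.
        (x1, u1) \<in> graph_op T \<longrightarrow> (x2, u2) \<in> graph_op T \<longrightarrow> (x3, u3) \<in> graph_op T \<longrightarrow>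
        inner u1 (x1 - x2) + inner u2 (x2 - x3) + inner u3 (x3 - x1) \<ge> 0)"

definition maximally_cyclically_monotone3 :: "('a::real_inner \<Rightarrow> 'a set) \<Rightarrow> bool" where
  "maximally_cyclically_monotone3 T \<longleftrightarrow>
     cyclically_monotone3 T \<and>
     \<not> (\<exists>S. cyclically_monotone3 S \<and> graph_op T \<subset> graph_op S)"

lemma resolvent_unique:
  fixes T :: "'a::real_inner \<Rightarrow> 'a set"
  assumes T: "cyclically_monotone3 T" and lam: "lam > 0"
    and y: "y \<in> resolvent lam T z" and y': "y' \<in> resolvent lam T z"
  shows "y = y'"
proof -
  obtain u where u: "u \<in> T y" "z = y + lam *\<^sub>R u"
    using y by (auto simp: resolvent_def inverse_op_def)
  obtain u' where u': "u' \<in> T y'" "z = y' + lam *\<^sub>R u'"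
    using y' by (auto simp: resolvent_def inverse_op_def)
  have "inner u (y - y') + inner u' (y' - y) + inner u (y - y) \<ge> 0"
    using T u(1) u'(1) unfolding cyclically_monotone3_def graph_op_def by blast
  then have "inner (u - u') (y - y') \<ge> 0"
    by (simp add: inner_diff_left inner_diff_right)
  then have "lam * inner (u - u') (y - y') \<ge> 0"
    using lam by simp
  moreover have "y - y' = - (lam *\<^sub>R (u - u'))"
    using u(2) u'(2) by (simp add: algebra_simps)
  then have "inner (y - y') (y - y') = - (lam * inner (u - u') (y - y'))"
    by (metis inner_minus_left inner_scaleR_left)
  ultimately have "inner (y - y') (y - y') \<le> 0"
    by linarith
  then show ?thesis
    by (metis inner_ge_zero inner_eq_zero_iff order_antisym eq_iff_diff_eq_0)
qed

end

theory Submission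
  imports Defs
begin

text \<open>With \<open>w\<^sub>k = F x\<^sub>k + \<xi>\<^sub>k\<close> and \<open>n = k + 1\<close>, the potential
  \<open>V\<^sub>k = n\<^sup>2 \<eta>/2 \<parallel>w\<^sub>k\<parallel>\<^sup>2 + n \<langle>w\<^sub>k, x\<^sub>k - x\<^sub>0\<rangle>\<close> is nonincreasing. One step combines
  monotonicity of \<open>F\<close> at \<open>x\<^sub>k, x\<^sub>k\<^sub>+\<^sub>1\<close>, the Lipschitz bound at \<open>x\<^sub>k\<^sub>+\<^sub>1, y\<^sub>k\<close> (with
  \<open>L \<eta> \<le> 1\<close>), and 3-cyclic monotonicity of \<open>T\<close> along \<open>x\<^sub>k\<^sub>+\<^sub>1 \<rightarrow> x\<^sub>k \<rightarrow> y\<^sub>k\<close>; what remains is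
  \<open>-n\<^sup>2 \<eta>/2 \<parallel>\<zeta>\<^sub>k - \<xi>\<^sub>k\<parallel>\<^sup>2\<close>, where \<open>\<zeta>\<^sub>k \<in> T y\<^sub>k\<close> is the element selected by the resolvent.
  Since \<open>\<langle>w\<^sub>k, x\<^sub>k - x\<^sup>\<star>\<rangle> \<ge> 0\<close>, Young's inequality turns \<open>V\<^sub>k \<le> V\<^sub>0\<close> into the rate.\<close>

lemma cyclically_monotone3D:
  assumes "cyclically_monotone3 T" "u1 \<in> T x1" "u2 \<in> T x2" "u3 \<in> T x3"
  shows "0 \<le> inner u1 (x1 - x2) + inner u2 (x2 - x3) + inner u3 (x3 - x1)"
  using assms unfolding cyclically_monotone3_def graph_op_def by blast

lemma cyclically_monotone3_imp_monotone:
  assumes "cyclically_monotone3 T" "u \<in> T x" "v \<in> T z"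
  shows "0 \<le> inner (u - v) (x - z)"
  using cyclically_monotone3D[OF assms(1,2,3,3)] by (simp add: inner_diff_left inner_diff_right)

lemma resolventE:
  assumes "z \<in> resolvent lam T c"
  obtains u where "u \<in> T z" "c = z + lam *\<^sub>R u"
  using assms by (auto simp: resolvent_def inverse_op_def)

lemma resolvent_residual:
  assumes "z \<in> resolvent lam T c" "lam > 0"
  shows "(1 / lam) *\<^sub>R (c - z) \<in> T z"
  using assms by (auto elim!: resolventE)

definition anchor_potential :: "real \<Rightarrow> real \<Rightarrow> 'a::real_inner \<Rightarrow> 'a \<Rightarrow> real" where
  "anchor_potential \<eta> n w p = n\<^sup>2 * \<eta> / 2 * (norm w)\<^sup>2 + n * inner w p"

text \<open>Pure algebra, free of \<open>F\<close> and \<open>T\<close>: it will be applied with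
  \<open>g\<close> as F at y plus the next \<xi>, \<open>v\<close> as F at x plus \<zeta>, and
  \<open>n + 1\<close> as the inverse of \<tau>, which clears denominators in both updates.\<close>

lemma anchor_potential_step:
  fixes x x' x0 y w w' g v :: "'a::real_inner"
  assumes n: "n \<ge> 0" and \<eta>: "\<eta> > 0"
    and x': "(n + 1) *\<^sub>R x' = x0 + n *\<^sub>R x - ((n + 1) * \<eta>) *\<^sub>R g"
    and y: "(n + 1) *\<^sub>R y = x0 + n *\<^sub>R x - (n * \<eta>) *\<^sub>R v"
    and mono: "0 \<le> inner (w' - w) (x' - x) + inner (v - w) (y - x')"
    and lip: "norm (w' - g) \<le> norm (x' - y) / \<eta>"
  shows "anchor_potential \<eta> (n + 1) w' (x' - x0) \<le> anchor_potential \<eta> n w (x - x0)"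
proof -
  define d where "d = x' - x"
  define r where "r = (n + 1) *\<^sub>R g - n *\<^sub>R v"
  have x'_eq: "x' = x + d"
    by (simp add: d_def)
  \<comment> \<open>Eliminating the anchor leaves \<open>x\<close>, \<open>d\<close>,
    \<open>g\<close>, \<open>v\<close>, \<open>w\<close>, \<open>w'\<close> unconstrained, so the
    decrease below is a polynomial identity.\<close>
  have x0_eq: "x0 = x + (n + 1) *\<^sub>R d + ((n + 1) * \<eta>) *\<^sub>R g"
    using x' by (simp add: x'_eq algebra_simps)
  have yx': "(n + 1) *\<^sub>R (y - x') = \<eta> *\<^sub>R r"
    using x' y by (simp add: r_def algebra_simps)
  have "(n + 1) * (norm (w' - g) * \<eta>) \<le> (n + 1) * norm (x' - y)"
    using lip n \<eta> by (intro mult_left_mono) (auto simp: pos_le_divide_eq)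
  also have "\<dots> = \<eta> * norm r"
    using arg_cong[OF yx', of norm] n \<eta> by (simp add: norm_minus_commute)
  finally have "(n + 1) * norm (w' - g) \<le> norm r"
    using \<eta> by (simp add: mult.left_commute mult.commute)
  then have "((n + 1) * norm (w' - g))\<^sup>2 \<le> (norm r)\<^sup>2"
    using n by (intro power_mono) auto
  then have lip2: "\<eta> / 2 * ((n + 1)\<^sup>2 * inner (w' - g) (w' - g)) \<le> \<eta> / 2 * inner r r"
    using \<eta> by (simp add: power_mult_distrib power2_norm_eq_inner)
  have "0 \<le> n * ((n + 1) * (inner (w' - w) d + inner (v - w) (y - x')))"
    using mono n by (simp add: d_def)
  also have "\<dots> = n * ((n + 1) * inner (w' - w) d + inner (v - w) (\<eta> *\<^sub>R r))"
    unfolding yx'[symmetric] by (simp add: algebra_simps)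
  finally have mono2: "0 \<le> n * ((n + 1) * inner (w' - w) d + inner (v - w) (\<eta> *\<^sub>R r))" .
  \<comment> \<open>The multipliers are \<open>n * (n + 1)\<close> for \<open>mono\<close> and
    \<open>\<eta> / 2\<close> for the squared \<open>lip\<close>; the remainder is a square.\<close>
  have "anchor_potential \<eta> n w (x - x0) - anchor_potential \<eta> (n + 1) w' (x' - x0)
      = n * ((n + 1) * inner (w' - w) d + inner (v - w) (\<eta> *\<^sub>R r))
        + (\<eta> / 2 * inner r r - \<eta> / 2 * ((n + 1)\<^sup>2 * inner (w' - g) (w' - g)))
        + n\<^sup>2 * \<eta> / 2 * inner (v - w) (v - w)"
    unfolding anchor_potential_def x'_eq x0_eq r_def power2_norm_eq_inner
    by (simp add: inner_simps inner_commute power2_eq_square field_simps)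
  moreover have "0 \<le> n\<^sup>2 * \<eta> / 2 * inner (v - w) (v - w)"
    using \<eta> by simp
  ultimately show ?thesis
    using lip2 mono2 by linarith
qed

text \<open>Here \<open>s\<close> is anchor minus zero and \<open>p\<close> iterate minus anchor. By
  \<open>pos\<close>, the cross term is at least \<open>- norm w * norm s\<close>; half of the
  quadratic term absorbs this.\<close>

lemma anchor_potential_bound:
  fixes w p s :: "'a::real_inner"
  assumes \<eta>: "\<eta> > 0" and n: "n > 0"
    and pos: "0 \<le> inner w (p + s)"
    and V: "anchor_potential \<eta> n w p \<le> c"
  shows "(norm w)\<^sup>2 \<le> (4 * (norm s)\<^sup>2 + 4 * \<eta> * c) / (\<eta>\<^sup>2 * n\<^sup>2)"
proof -
  have "- inner w p \<le> norm w * norm s"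
    using pos norm_cauchy_schwarz[of w s] by (simp add: inner_add_right)
  then have "n * (- inner w p) \<le> n * (norm w * norm s)"
    using n by (intro mult_left_mono) auto
  with V have "n\<^sup>2 * \<eta> / 2 * (norm w)\<^sup>2 \<le> c + n * (norm w * norm s)"
    by (simp add: anchor_potential_def)
  then have "4 * \<eta> * (n\<^sup>2 * \<eta> / 2 * (norm w)\<^sup>2) \<le> 4 * \<eta> * (c + n * (norm w * norm s))"
    using \<eta> by (intro mult_left_mono) auto
  moreover have "0 \<le> (\<eta> * n * norm w - 2 * norm s)\<^sup>2"
    by simp
  ultimately have "(norm w)\<^sup>2 * (\<eta>\<^sup>2 * n\<^sup>2) \<le> 4 * (norm s)\<^sup>2 + 4 * \<eta> * c"
    by (simp add: power2_eq_square algebra_simps)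
  then show ?thesis
    using \<eta> n by (simp add: pos_le_divide_eq)
qed

lemma bigo_inverse_of_square_bound:
  fixes f :: "nat \<Rightarrow> real"
  assumes "\<And>k. (f k)\<^sup>2 \<le> C / (c * (real k + 1)\<^sup>2)" "c > 0" "C \<ge> 0"
  shows "f \<in> O(\<lambda>k. 1 / real k)"
proof (rule bigoI)
  show "\<forall>\<^sub>F k in sequentially. norm (f k) \<le> sqrt (C / c) * norm (1 / real k)"
    \<comment> \<open>At \<open>k = 0\<close> the comparison function is \<open>1 / 0 = 0\<close>,
      so that index is dropped.\<close>
    using eventually_gt_at_top[of 0]
  proof eventually_elim
    case (elim k)
    have "(f k)\<^sup>2 \<le> C / c / (real k + 1)\<^sup>2"
      using assms(1)[of k] by simp
    also have "\<dots> \<le> C / c / (real k)\<^sup>2"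
      using elim assms(2,3) by (intro divide_left_mono power_mono) auto
    finally have "sqrt ((f k)\<^sup>2) \<le> sqrt (C / c / (real k)\<^sup>2)"
      by (rule real_sqrt_le_mono)
    then show ?case
      by (simp add: real_sqrt_divide real_sqrt_mult)
  qed
qed

theorem theorem7p1:
  fixes D :: "(real ^ 'p) set"
    and F :: "real ^ 'p \<Rightarrow> real ^ 'p"
    and T :: "real ^ 'p \<Rightarrow> (real ^ 'p) set"
    and L \<eta> :: real
    and \<tau> \<eta>h :: "nat \<Rightarrow> real"
    and x y \<xi> :: "nat \<Rightarrow> real ^ 'p"
  assumes "L > 0"
    and "monotone_map_on D F"
    and "L-lipschitz_on D F"
    and "maximally_cyclically_monotone3 T"
    and "zer (sum_op D F T) \<noteq> {}"
    and "0 < \<eta>" and "\<eta> \<le> 1 / L"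
    and "\<And>k. \<tau> k = 1 / (real k + 2)"
    and "\<And>k. \<eta>h k = (1 - \<tau> k) * \<eta>"
    and "x 0 \<in> dom_op (sum_op D F T)"
    and "\<And>k. x k \<in> D" and "\<And>k. y k \<in> D"
    and "\<And>k. y k \<in> resolvent (\<eta>h k) T
               (\<tau> k *\<^sub>R x 0 + (1 - \<tau> k) *\<^sub>R x k - \<eta>h k *\<^sub>R F (x k))"
    and "\<And>k. x (Suc k) \<in> resolvent \<eta> T
               (\<tau> k *\<^sub>R x 0 + (1 - \<tau> k) *\<^sub>R x k - \<eta> *\<^sub>R F (y k))"
    and "\<xi> 0 \<in> T (x 0)"
    and "\<And>k. \<xi> (Suc k) =
               (1 / \<eta>) *\<^sub>R (\<tau> k *\<^sub>R x 0 + (1 - \<tau> k) *\<^sub>R x k - \<eta> *\<^sub>R F (y k) - x (Suc k))"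
  shows "(\<forall>k. \<forall>xstar \<in> zer (sum_op D F T).
            (norm (F (x k) + \<xi> k))\<^sup>2
              \<le> (4 * (norm (x 0 - xstar))\<^sup>2 + 2 * \<eta>\<^sup>2 * (norm (F (x 0) + \<xi> 0))\<^sup>2)
                  / (\<eta>\<^sup>2 * (real k + 1)\<^sup>2))
         \<and> (\<lambda>k. norm (F (x k) + \<xi> k)) \<in> O(\<lambda>k. 1 / real k)"
proof -
  note L = assms(1) and Fmono = assms(2) and Flip = assms(3) and zer = assms(5)
    and \<eta> = assms(6) and \<eta>L = assms(7) and \<tau> = assms(8) and \<eta>h = assms(9)
    and xD = assms(11) and yD = assms(12) and yres = assms(13) and xres = assms(14)
    and \<xi>0 = assms(15) and \<xi>Suc = assms(16)
  have T: "cyclically_monotone3 T"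
    using assms(4) by (simp add: maximally_cyclically_monotone3_def)
  have \<xi>T: "\<xi> k \<in> T (x k)" for k
    using \<xi>0 resolvent_residual[OF xres \<eta>] by (cases k) (simp_all add: \<xi>Suc)
  define w where "w k = F (x k) + \<xi> k" for k
  define V where "V k = anchor_potential \<eta> (real k + 1) (w k) (x k - x 0)" for k
  have V_Suc: "V (Suc k) \<le> V k" for k
  proof -
    define n where "n = real k + 1"
    have n: "n > 0" and \<tau>n: "(n + 1) * \<tau> k = 1" "(n + 1) * (1 - \<tau> k) = n"
      by (simp_all add: n_def \<tau> field_simps)
    have \<eta>hn: "(n + 1) * \<eta>h k = n * \<eta>"
      unfolding \<eta>h by (metis \<tau>n(2) mult.assoc)
    obtain \<zeta> where \<zeta>: "\<zeta> \<in> T (y k)"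
      and yeq: "\<tau> k *\<^sub>R x 0 + (1 - \<tau> k) *\<^sub>R x k - \<eta>h k *\<^sub>R F (x k) = y k + \<eta>h k *\<^sub>R \<zeta>"
      by (rule resolventE[OF yres])
    have anchor: "(n + 1) *\<^sub>R (\<tau> k *\<^sub>R x 0 + (1 - \<tau> k) *\<^sub>R x k) = x 0 + n *\<^sub>R x k"
      unfolding scaleR_add_right scaleR_scaleR \<tau>n by simp
    have y': "y k = (\<tau> k *\<^sub>R x 0 + (1 - \<tau> k) *\<^sub>R x k) - \<eta>h k *\<^sub>R (F (x k) + \<zeta>)"
      using yeq by (simp add: algebra_simps)
    have x': "x (Suc k) = (\<tau> k *\<^sub>R x 0 + (1 - \<tau> k) *\<^sub>R x k) - \<eta> *\<^sub>R (F (y k) + \<xi> (Suc k))"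
      unfolding \<xi>Suc using \<eta> by (simp add: scaleR_add_right)
    have "anchor_potential \<eta> (n + 1) (w (Suc k)) (x (Suc k) - x 0)
        \<le> anchor_potential \<eta> n (w k) (x k - x 0)"
    proof (rule anchor_potential_step)
      show "(n + 1) *\<^sub>R x (Suc k) = x 0 + n *\<^sub>R x k - ((n + 1) * \<eta>) *\<^sub>R (F (y k) + \<xi> (Suc k))"
        by (subst x') (simp only: scaleR_diff_right scaleR_scaleR anchor)
      show "(n + 1) *\<^sub>R y k = x 0 + n *\<^sub>R x k - (n * \<eta>) *\<^sub>R (F (x k) + \<zeta>)"
        by (subst y') (simp only: scaleR_diff_right scaleR_scaleR anchor \<eta>hn)
      have "0 \<le> inner (F (x (Suc k)) - F (x k)) (x (Suc k) - x k)"
        using Fmono xD by (simp add: monotone_map_on_def)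
      moreover have "0 \<le> inner (\<xi> (Suc k)) (x (Suc k) - x k) + inner (\<xi> k) (x k - y k)
          + inner \<zeta> (y k - x (Suc k))"
        by (rule cyclically_monotone3D[OF T \<xi>T \<xi>T \<zeta>])
      \<comment> \<open>In the second product \<open>F (x k)\<close> cancels, leaving
        \<open>\<zeta> - \<xi> k\<close>; the \<xi> and \<zeta> terms then regroup into the 3-cycle
        sum.\<close>
      ultimately show "0 \<le> inner (w (Suc k) - w k) (x (Suc k) - x k)
          + inner (F (x k) + \<zeta> - w k) (y k - x (Suc k))"
        by (simp add: w_def inner_simps)
      have "norm (F (x (Suc k)) - F (y k)) \<le> L * norm (x (Suc k) - y k)"
        using lipschitz_onD[OF Flip xD yD] by (simp add: dist_norm)
      also have "\<dots> \<le> 1 / \<eta> * norm (x (Suc k) - y k)"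
        using L \<eta> \<eta>L by (intro mult_right_mono) (auto simp: field_simps)
      finally show "norm (w (Suc k) - (F (y k) + \<xi> (Suc k))) \<le> norm (x (Suc k) - y k) / \<eta>"
        by (simp add: w_def)
    qed (use n \<eta> in auto)
    then show ?thesis
      by (simp add: V_def n_def add.commute)
  qed
  \<comment> \<open>The inner product in \<open>V 0\<close> vanishes because the anchor is the
    starting point.\<close>
  have V_le: "V k \<le> \<eta> / 2 * (norm (w 0))\<^sup>2" for k
    using lift_Suc_antimono_le[of V, OF V_Suc, of 0 k] by (simp add: V_def anchor_potential_def)
  have rate: "(norm (w k))\<^sup>2 \<le> (4 * (norm (x 0 - xs))\<^sup>2 + 2 * \<eta>\<^sup>2 * (norm (w 0))\<^sup>2)
      / (\<eta>\<^sup>2 * (real k + 1)\<^sup>2)" if xs: "xs \<in> zer (sum_op D F T)" for k xs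
  proof -
    obtain u where u: "xs \<in> D" "u \<in> T xs" "F xs + u = 0"
      using xs by (auto simp: zer_def sum_op_def split: if_splits)
    \<comment> \<open>Monotonicity of the sum, tested against the zero \<open>xs\<close>, gives the
      sign condition \<open>pos\<close>.\<close>
    have "0 \<le> inner (F (x k) - F xs) (x k - xs) + inner (\<xi> k - u) (x k - xs)"
      using Fmono xD u cyclically_monotone3_imp_monotone[OF T \<xi>T u(2)]
      by (simp add: monotone_map_on_def)
    also have "\<dots> = inner (w k - (F xs + u)) (x k - xs)"
      by (simp add: w_def inner_simps)
    finally have "0 \<le> inner (w k) ((x k - x 0) + (x 0 - xs))"
      by (simp add: u(3))
    from anchor_potential_bound[OF \<eta> _ this V_le[unfolded V_def]]
    show ?thesis
      by (simp add: power2_eq_square mult.assoc)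
  qed
  obtain xs where "xs \<in> zer (sum_op D F T)"
    using zer by blast
  then have "(\<lambda>k. norm (w k)) \<in> O(\<lambda>k. 1 / real k)"
    by (intro bigo_inverse_of_square_bound[OF rate]) (use \<eta> in auto)
  with rate show ?thesis
    by (auto simp: w_def)
qed

end
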